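(* Let $G$ be a symmetrically complete ordered abelian group or a symmetrically complete ordered field, and let $\mathcal{B}$ be the set of all nonempty convex subsets of $G$ that are finite unions of closed bounded intervals and ultrametric balls. Then the ball space $(G,\mathcal{B})$ is spherically complete.
   Context: A ball space is a pair $(X,\mathcal{B})$ where $X$ is a nonempty set and $\mathcal{B}$ is a nonempty set of nonempty subsets of $X$; the elements of $\mathcal{B}$ are called balls. A nest of balls in $\mathcal{B}$ is a nonempty subset $\mathcal{N}\subseteq\mathcal{B}$ that is totally ordered by inclusion. $(X,\mathcal{B})$ is spherically complete if $\bigcap\mathcal{N}\neq\emptyset$ for every nest $\mathcal{N}$ of balls in $\mathcal{B}$. All orderings of groups and fields are total. A Dedekind cut in $G$ is a pair $(C,D)$ of nonempty subsets with $C\cup D=G$ and $c<d$ for all $c\in C$, $d\in D$. $G$ is symmetrically complete if for every Dedekind cut $(C,D)$ the cofinality of $C$ is different from the coinitiality of $D$ (the cofinality of a totally ordered set is the least cardinality of a cofinal subset; coinitiality is the cofinality for the reversed order). Closed bounded intervals are the sets $[a,b]=\{x\in G\mid a\le x\le b\}$ with $a,b\in G$, $a\leq b$. A subset $S\subseteq G$ is convex if $a,b\in S$ and $a\le x\le b$ imply $x\in S$. Natural valuation: for an ordered abelian group $G$ (for an ordered field, use its ordered additive group), $a,b\in G$ are archimedean equivalent if there is $n\in\mathbb{N}$ with $n|a|\ge|b|$ and $n|b|\ge|a|$. Let $va$ be the archimedean equivalence class of $a$, order the classes by $va>vb$ iff $n|a|<|b|$ for all $n\in\mathbb{N}$, i.e.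 iff $|a|<|b|$ and $a,b$ are not archimedean equivalent, and write $\infty:=v0$, the largest class. Put $u(a,b):=v(a-b)$. The ultrametric balls of $G$ are the sets $B(x,y):=\{z\in G\mid u(x,z)\ge u(x,y)\}$ with $x,y\in G$ (singletons $B(x,x)=\{x\}$ are included). *)

theory Defs
  imports Main
begin

unbundle cardinal_syntax

section \<open>Ball spaces\<close>

definition ball_space :: "'a set \<Rightarrow> 'a set set \<Rightarrow> bool" where
  "ball_space X \<B> \<longleftrightarrow> X \<noteq> {} \<and> \<B> \<noteq> {} \<and> (\<forall>B\<in>\<B>. B \<noteq> {} \<and> B \<subseteq> X)"

definition nest_of_balls :: "'a set set \<Rightarrow> 'a set set \<Rightarrow> bool" where
  "nest_of_balls \<B> \<N> \<longleftrightarrow> \<N> \<noteq> {} \<and> \<N> \<in> chains \<B>"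

definition spherically_complete :: "'a set set \<Rightarrow> bool" where
  "spherically_complete \<B> \<longleftrightarrow> (\<forall>\<N>. nest_of_balls \<B> \<N> \<longrightarrow> \<Inter>\<N> \<noteq> {})"


section \<open>Cofinality and symmetric completeness\<close>

text \<open>
  The library constant \<open>cofinal\<close> demands a strictly larger element and is therefore
  not usable for sets with a last element; below, such sets have cofinality 1.
\<close>

definition cofinal_in :: "('a \<Rightarrow> 'a \<Rightarrow> bool) \<Rightarrow> 'a set \<Rightarrow> 'a set \<Rightarrow> bool" where
  "cofinal_in le S A \<longleftrightarrow> A \<subseteq> S \<and> (\<forall>x\<in>S. \<exists>y\<in>A. le x y)"

text \<open>
  A cardinal is represented, as in the library, by a cardinal order, which is only
  determined up to \<open>=o\<close>; equality of cofinalities has to be expressed by \<open>=o\<close>.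
\<close>

definition cofinality :: "('a \<Rightarrow> 'a \<Rightarrow> bool) \<Rightarrow> 'a set \<Rightarrow> 'a rel" where
  "cofinality le S =
    (SOME r. \<exists>A. cofinal_in le S A \<and> r = |A| \<and> (\<forall>B. cofinal_in le S B \<longrightarrow> |A| \<le>o |B| ))"

lemma cofinality_attained:
  assumes refl: "\<And>x. x \<in> S \<Longrightarrow> le x x"
  shows "\<exists>A. cofinal_in le S A \<and> cofinality le S = |A| \<and>
           (\<forall>B. cofinal_in le S B \<longrightarrow> |A| \<le>o |B| )"
proof -
  let ?R = "card_of ` {A. cofinal_in le S A}"
  have "cofinal_in le S S"
    using refl by (auto simp: cofinal_in_def)
  then have "?R \<noteq> {}" by blast
  moreover have "\<forall>r\<in>?R. Card_order r" by (auto intro: card_of_Card_order)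
  ultimately have "\<exists>r\<in>?R. \<forall>r'\<in>?R. r \<le>o r'"
    by (intro exists_minim_Card_order) auto
  then have "\<exists>r A. cofinal_in le S A \<and> r = |A| \<and> (\<forall>B. cofinal_in le S B \<longrightarrow> |A| \<le>o |B| )"
    by blast
  from someI_ex[OF this] show ?thesis
    unfolding cofinality_def .
qed

definition coinitiality :: "'a::linorder set \<Rightarrow> 'a rel" where
  "coinitiality S = cofinality (\<ge>) S"

definition dedekind_cut :: "'a::linorder set \<Rightarrow> 'a set \<Rightarrow> bool" where
  "dedekind_cut C D \<longleftrightarrow>
    C \<noteq> {} \<and> D \<noteq> {} \<and> C \<union> D = UNIV \<and> (\<forall>c\<in>C. \<forall>d\<in>D. c < d)"

definition symmetrically_complete :: "'a::linorder itself \<Rightarrow> bool" where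
  "symmetrically_complete _ \<longleftrightarrow>
    (\<forall>C D :: 'a set. dedekind_cut C D \<longrightarrow> \<not> cofinality (\<le>) C =o coinitiality D)"


section \<open>The natural valuation\<close>

primrec nat_mult :: "nat \<Rightarrow> 'a::monoid_add \<Rightarrow> 'a" where
  "nat_mult 0 x = 0"
| "nat_mult (Suc n) x = x + nat_mult n x"

text \<open>The class of ordered abelian groups does not provide an absolute value.\<close>

definition grp_abs :: "'a::linordered_ab_group_add \<Rightarrow> 'a" where
  "grp_abs a = max a (- a)"

lemma grp_abs_eq_abs: "grp_abs (a :: 'a::linordered_idom) = \<bar>a\<bar>"
  by (auto simp: grp_abs_def abs_if max_def)

lemma grp_abs_nonneg: "0 \<le> grp_abs a"
  by (auto simp: grp_abs_def le_max_iff_disj)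

lemma nat_mult_eq_of_nat: "nat_mult n (x :: 'a::semiring_1) = of_nat n * x"
  by (induction n) (auto simp: distrib_right)

definition arch_equiv :: "'a::linordered_ab_group_add \<Rightarrow> 'a \<Rightarrow> bool" where
  "arch_equiv a b \<longleftrightarrow> (\<exists>n. nat_mult n (grp_abs a) \<ge> grp_abs b \<and> nat_mult n (grp_abs b) \<ge> grp_abs a)"

lemma nat_mult_add: "nat_mult (m + n) x = nat_mult m x + nat_mult n x"
  by (induction m) (auto simp: add.assoc)

lemma nat_mult_mult: "nat_mult (m * n) x = nat_mult m (nat_mult n x)"
  by (induction m) (auto simp: nat_mult_add)

lemma nat_mult_nonneg: "0 \<le> x \<Longrightarrow> 0 \<le> nat_mult n (x :: 'a::linordered_ab_group_add)"
  by (induction n) auto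

lemma nat_mult_mono:
  fixes x y :: "'a::linordered_ab_group_add"
  shows "x \<le> y \<Longrightarrow> nat_mult n x \<le> nat_mult n y"
  by (induction n) (auto intro: add_mono)

lemma nat_mult_mono_left:
  fixes x :: "'a::linordered_ab_group_add"
  assumes "0 \<le> x" and "m \<le> n"
  shows "nat_mult m x \<le> nat_mult n x"
  using nat_mult_nonneg[OF assms(1), of "n - m"] assms(2)
    nat_mult_add[of m "n - m" x] by simp

definition arch_dominates :: "'a::linordered_ab_group_add \<Rightarrow> 'a \<Rightarrow> bool" where
  "arch_dominates a b \<longleftrightarrow> (\<exists>n. grp_abs b \<le> nat_mult n (grp_abs a))"

lemma arch_dominates_total: "arch_dominates a b \<or> arch_dominates b a"
proof -
  have "grp_abs x \<le> grp_abs y \<Longrightarrow> arch_dominates y x" for x y :: 'a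
    unfolding arch_dominates_def by (rule exI[of _ "Suc 0"]) simp
  then show ?thesis using linear[of "grp_abs a" "grp_abs b"] by blast
qed

lemma arch_dominates_refl: "arch_dominates a a"
  using arch_dominates_total by blast

lemma arch_dominates_trans:
  assumes "arch_dominates a b" and "arch_dominates b c"
  shows "arch_dominates a c"
proof -
  from assms obtain m n where "grp_abs b \<le> nat_mult m (grp_abs a)" and "grp_abs c \<le> nat_mult n (grp_abs b)"
    by (auto simp: arch_dominates_def)
  then have "grp_abs c \<le> nat_mult (n * m) (grp_abs a)"
    unfolding nat_mult_mult using nat_mult_mono order_trans by blast
  then show ?thesis by (auto simp: arch_dominates_def)
qed

lemma arch_equiv_iff_dominates: "arch_equiv a b \<longleftrightarrow> arch_dominates a b \<and> arch_dominates b a"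
proof
  assume "arch_dominates a b \<and> arch_dominates b a"
  then obtain m n where *: "grp_abs b \<le> nat_mult m (grp_abs a)" "grp_abs a \<le> nat_mult n (grp_abs b)"
    by (auto simp: arch_dominates_def)
  have "grp_abs b \<le> nat_mult (max m n) (grp_abs a)"
    using *(1) nat_mult_mono_left[OF grp_abs_nonneg, of m "max m n" a] by simp
  moreover have "grp_abs a \<le> nat_mult (max m n) (grp_abs b)"
    using *(2) nat_mult_mono_left[OF grp_abs_nonneg, of n "max m n" b] by simp
  ultimately show "arch_equiv a b" by (auto simp: arch_equiv_def)
qed (auto simp: arch_equiv_def arch_dominates_def)

quotient_type (overloaded) 'a arch_class = "'a::linordered_ab_group_add" / arch_equiv
proof (rule equivpI)
  show "reflp (arch_equiv :: 'a \<Rightarrow> _)"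
    by (auto intro: reflpI simp: arch_equiv_iff_dominates arch_dominates_refl)
  show "symp (arch_equiv :: 'a \<Rightarrow> _)"
    by (auto intro: sympI simp: arch_equiv_iff_dominates)
  show "transp (arch_equiv :: 'a \<Rightarrow> _)"
    by (auto intro!: transpI simp: arch_equiv_iff_dominates intro: arch_dominates_trans)
qed

lift_definition natural_val :: "'a::linordered_ab_group_add \<Rightarrow> 'a arch_class" is "\<lambda>a. a" .

lemma not_arch_dominates_iff: "(\<forall>n. nat_mult n (grp_abs b) < grp_abs a) \<longleftrightarrow> \<not> arch_dominates b a"
  by (auto simp: arch_dominates_def not_le)

text \<open>Larger classes consist of elements of smaller absolute value.\<close>

instantiation arch_class :: (linordered_ab_group_add) linorder
begin

lift_definition less_arch_class :: "'a arch_class \<Rightarrow> 'a arch_class \<Rightarrow> bool"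
  is "\<lambda>a b. \<forall>n. nat_mult n (grp_abs b) < grp_abs a"
  unfolding not_arch_dominates_iff arch_equiv_iff_dominates
  by (blast intro: arch_dominates_trans)

definition less_eq_arch_class :: "'a arch_class \<Rightarrow> 'a arch_class \<Rightarrow> bool" where
  "less_eq_arch_class V W \<longleftrightarrow> V < W \<or> V = W"

lemma less_eq_arch_class_iff: "natural_val a \<le> natural_val b \<longleftrightarrow> arch_dominates a b"
  unfolding less_eq_arch_class_def
  by transfer (metis not_arch_dominates_iff arch_equiv_iff_dominates arch_dominates_total)

lemma less_arch_class_iff: "natural_val a < natural_val b \<longleftrightarrow> \<not> arch_dominates b a"
  by transfer (rule not_arch_dominates_iff)

lemma natural_val_eq_iff: "natural_val a = natural_val b \<longleftrightarrow> arch_equiv a b"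
  by transfer (rule refl)

lemma natural_val_surj: "\<exists>a. V = natural_val a"
  by transfer (auto simp: arch_equiv_iff_dominates intro: arch_dominates_refl)

instance
proof
  fix V W U :: "'a arch_class"
  obtain a b c where [simp]: "V = natural_val a" "W = natural_val b" "U = natural_val c"
    using natural_val_surj by metis
  show "V < W \<longleftrightarrow> V \<le> W \<and> \<not> W \<le> V"
    using arch_dominates_total[of a b]
    by (auto simp: less_eq_arch_class_iff less_arch_class_iff)
  show "V \<le> V"
    by (simp add: less_eq_arch_class_def)
  show "V \<le> W \<Longrightarrow> W \<le> U \<Longrightarrow> V \<le> U"
    by (auto simp: less_eq_arch_class_iff intro: arch_dominates_trans)
  show "V \<le> W \<Longrightarrow> W \<le> V \<Longrightarrow> V = W"
    by (auto simp: less_eq_arch_class_iff natural_val_eq_iff arch_equiv_iff_dominates)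
  show "V \<le> W \<or> W \<le> V"
    using arch_dominates_total[of a b] by (auto simp: less_eq_arch_class_iff)
qed

end

lemma natural_val_less_iff:
  "natural_val a > natural_val b \<longleftrightarrow> (\<forall>n. nat_mult n (grp_abs a) < grp_abs b)"
  by (simp add: less_arch_class_iff not_arch_dominates_iff)

lemma natural_val_le_zero: "natural_val a \<le> natural_val 0"
  using grp_abs_nonneg[of a]
  by (auto simp: less_eq_arch_class_iff arch_dominates_def grp_abs_def intro: exI[of _ "0::nat"])

definition natural_ultrametric :: "'a::linordered_ab_group_add \<Rightarrow> 'a \<Rightarrow> 'a arch_class" where
  "natural_ultrametric a b = natural_val (a - b)"

definition ultrametric_ball :: "'a::linordered_ab_group_add \<Rightarrow> 'a \<Rightarrow> 'a set" where
  "ultrametric_ball x y = {z. natural_ultrametric x z \<ge> natural_ultrametric x y}"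

lemma ultrametric_ball_singleton:
  fixes x :: "'a::linordered_ab_group_add"
  shows "ultrametric_ball x x = {x}"
proof -
  have "nat_mult n (0::'a) = 0" for n by (induction n) auto
  moreover have "grp_abs z \<le> 0 \<longleftrightarrow> z = 0" for z :: 'a
    by (auto simp: grp_abs_def intro: order_antisym)
  ultimately have "arch_dominates 0 z \<longleftrightarrow> z = 0" for z :: 'a
    by (simp add: arch_dominates_def grp_abs_def)
  then show ?thesis
    by (auto simp: ultrametric_ball_def natural_ultrametric_def less_eq_arch_class_iff)
qed


section \<open>Convex finite unions of intervals and ultrametric balls\<close>

definition order_convex :: "'a::linorder set \<Rightarrow> bool" where
  "order_convex S \<longleftrightarrow> (\<forall>a\<in>S. \<forall>b\<in>S. \<forall>x. a \<le> x \<and> x \<le> b \<longrightarrow> x \<in> S)"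

definition closed_bounded_intervals :: "'a::linorder set set" where
  "closed_bounded_intervals = {{a..b} | a b. a \<le> b}"

definition ultrametric_balls :: "'a::linordered_ab_group_add set set" where
  "ultrametric_balls = {ultrametric_ball x y | x y. True}"

definition convex_finite_unions :: "'a::linordered_ab_group_add set set" where
  "convex_finite_unions =
    {S. S \<noteq> {} \<and> order_convex S \<and>
        (\<exists>\<F>. finite \<F> \<and> \<F> \<subseteq> closed_bounded_intervals \<union> ultrametric_balls \<and> S = \<Union>\<F>)}"

end

theory Submission
  imports Defs
begin

text \<open>
  Suppose a nest has empty intersection, and let \<open>L\<close> and \<open>U\<close> consist of the points lying strictly
  below, respectively strictly above, some member of the nest. By convexity \<open>(L, U)\<close> is a
  Dedekind cut. Every convex finite union ends, on either side, in a single ultrametric ball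
  (a minimum \<open>a\<close> being the ball \<open>{a}\<close>), and an ultrametric ball is determined by either edge.
  Hence if a member of the nest already had all of \<open>L\<close> strictly below it, its end ball would lie in
  every member; so no member realizes \<open>L\<close>, and dually none realizes \<open>U\<close>. Therefore the cofinality
  of \<open>L\<close> and the coinitiality of \<open>U\<close> both agree with that of the nest under reverse inclusion,
  which contradicts symmetric completeness.
\<close>

section \<open>Comparing cofinalities\<close>

lemma cofinality_le_of_map:
  assumes refl: "\<And>x. x \<in> L \<Longrightarrow> le x x" "\<And>x. x \<in> U \<Longrightarrow> le' x x"
    and f: "f ` L \<subseteq> U"
    and cofinal: "\<And>u. u \<in> U \<Longrightarrow> \<exists>l\<in>L. \<forall>a\<in>L. le l a \<longrightarrow> le' u (f a)"
  shows "cofinality le' U \<le>o cofinality le L"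
proof -
  obtain A where A: "cofinal_in le L A" "cofinality le L = |A|"
    using cofinality_attained[of L le] refl(1) by blast
  obtain B where B: "cofinality le' U = |B|" "\<And>C. cofinal_in le' U C \<Longrightarrow> |B| \<le>o |C|"
    using cofinality_attained[of U le'] refl(2) by blast
  have "cofinal_in le' U (f ` A)"
    unfolding cofinal_in_def
  proof (intro conjI ballI)
    show "f ` A \<subseteq> U"
      using A(1) f by (auto simp: cofinal_in_def)
    fix u assume "u \<in> U"
    then obtain l where l: "l \<in> L" "\<forall>a\<in>L. le l a \<longrightarrow> le' u (f a)"
      using cofinal by blast
    then obtain a where "a \<in> A" "le l a"
      using A(1) by (auto simp: cofinal_in_def)
    with l A(1) show "\<exists>y\<in>f ` A. le' u y"
      by (auto simp: cofinal_in_def)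
  qed
  then have "|B| \<le>o |f ` A|" by (rule B(2))
  also have "|f ` A| \<le>o |A|" by (rule card_of_image)
  finally show ?thesis by (simp add: A(2) B(1))
qed

text \<open>Moving towards the end of \<open>L\<close> forces the member witnessing membership in
  \<open>L\<close> to shrink, and this pushes the associated points of \<open>U\<close> past any
  given one. Keeping \<open>le\<close> abstract lets one proof yield both inequalities, with
  \<open>L\<close> and \<open>U\<close> exchanged.\<close>

lemma cofinality_le_of_chain:
  fixes le :: "'a \<Rightarrow> 'a \<Rightarrow> bool" and \<N> :: "'a set set"
  defines "L \<equiv> {x. \<exists>S\<in>\<N>. \<forall>s\<in>S. \<not> le s x}"
    and "U \<equiv> {x. \<exists>S\<in>\<N>. \<forall>s\<in>S. \<not> le x s}"
  assumes total: "\<And>x y. le x y \<or> le y x"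
    and trans: "\<And>x y z. le x y \<Longrightarrow> le y z \<Longrightarrow> le x z"
    and chain: "\<And>S T. S \<in> \<N> \<Longrightarrow> T \<in> \<N> \<Longrightarrow> S \<subseteq> T \<or> T \<subseteq> S"
    and L: "\<And>S. S \<in> \<N> \<Longrightarrow> \<exists>x\<in>L. \<exists>s\<in>S. le s x"
    and U: "\<And>S. S \<in> \<N> \<Longrightarrow> \<exists>x\<in>U. \<exists>s\<in>S. le x s"
  shows "cofinality (\<lambda>x y. le y x) U \<le>o cofinality le L"
proof -
  \<comment> \<open>The map \<open>f\<close> will pick, for a member \<open>S\<close> witnessing
    \<open>a \<in> L\<close>, a point of \<open>U\<close> that \<open>S\<close> does not realize;
    hypothesis \<open>U\<close> provides it.\<close>
  have "\<exists>u. u \<in> U \<and> (\<exists>S\<in>\<N>. (\<forall>s\<in>S. \<not> le s a) \<and> (\<exists>s\<in>S. le u s))" if a: "a \<in> L" for a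
  proof -
    obtain S where "S \<in> \<N>" "\<forall>s\<in>S. \<not> le s a"
      using a unfolding L_def by blast
    with U[of S] show ?thesis by metis
  qed
  then obtain f where f: "\<And>a. a \<in> L \<Longrightarrow> f a \<in> U"
      "\<And>a. a \<in> L \<Longrightarrow> \<exists>S\<in>\<N>. (\<forall>s\<in>S. \<not> le s a) \<and> (\<exists>s\<in>S. le (f a) s)"
    by metis
  show ?thesis
  proof (rule cofinality_le_of_map)
    show "le x x" for x using total[of x x] by blast
    then show "le x x" for x .
    show "f ` L \<subseteq> U" using f(1) by blast
    fix u assume "u \<in> U"
    then obtain S where S: "S \<in> \<N>" "\<forall>s\<in>S. \<not> le u s"
      unfolding U_def by blast
    obtain l s where l: "l \<in> L" "s \<in> S" "le s l"
      using L[OF S(1)] by metis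
    have "le (f a) u" if a: "a \<in> L" "le l a" for a
    proof -
      obtain T t where T: "T \<in> \<N>" "\<forall>s\<in>T. \<not> le s a" "t \<in> T" "le (f a) t"
        using f(2)[OF a(1)] by metis
      \<comment> \<open>From \<open>le s l\<close> and \<open>le l a\<close>, the point
        \<open>s\<close> of \<open>S\<close> is not beyond \<open>a\<close>, whereas all of
        \<open>T\<close> is. So \<open>T\<close> misses a point of \<open>S\<close> and must be the
        smaller of the two; hence \<open>t\<close> lies in \<open>S\<close> and so before
        \<open>u\<close>.\<close>
      have "s \<notin> T" using T(2) trans[OF l(3) a(2)] by blast
      then have "T \<subseteq> S" using chain[OF S(1) T(1)] l(2) by blast
      then have "le t u" using S(2) T(3) total[of t u] by blast
      with T(4) show ?thesis by (rule trans)
    qed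
    with l(1) show "\<exists>l\<in>L. \<forall>a\<in>L. le l a \<longrightarrow> le (f a) u" by blast
  qed
qed

section \<open>Ultrametric balls\<close>

lemma grp_abs_diff_le: "grp_abs (a - b) \<le> grp_abs a + grp_abs b"
proof -
  have "a - b \<le> grp_abs a + grp_abs b"
    unfolding diff_conv_add_uminus grp_abs_def by (intro add_mono) auto
  moreover have "- a + b \<le> grp_abs a + grp_abs b"
    unfolding grp_abs_def by (intro add_mono) auto
  ultimately show ?thesis by (simp add: grp_abs_def[of "a - b"])
qed

lemma arch_dominates_diff:
  assumes "arch_dominates c a" "arch_dominates c b"
  shows "arch_dominates c (a - b)"
proof -
  obtain m n where "grp_abs a \<le> nat_mult m (grp_abs c)" "grp_abs b \<le> nat_mult n (grp_abs c)"
    using assms by (auto simp: arch_dominates_def)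
  then have "grp_abs (a - b) \<le> nat_mult (m + n) (grp_abs c)"
    unfolding nat_mult_add using grp_abs_diff_le[of a b] add_mono order_trans by blast
  then show ?thesis by (auto simp: arch_dominates_def)
qed

lemma arch_dominates_between:
  assumes "arch_dominates c a" "arch_dominates c b" "a \<le> x" "x \<le> b"
  shows "arch_dominates c x"
proof -
  have "grp_abs x \<le> grp_abs a \<or> grp_abs x \<le> grp_abs b"
    using assms(3,4) by (cases "x \<le> - x") (auto simp: grp_abs_def le_max_iff_disj max_def)
  then show ?thesis
    using assms(1,2) by (auto simp: arch_dominates_def intro: order_trans)
qed

lemma ultrametric_ball_convex:
  assumes "B \<in> ultrametric_balls" "a \<in> B" "b \<in> B" "a \<le> x" "x \<le> b"
  shows "x \<in> B"
proof -
  obtain c d where "B = ultrametric_ball c d"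
    using assms(1) by (auto simp: ultrametric_balls_def)
  then show ?thesis
    using assms(2-) arch_dominates_between[of "c - d" "c - b" "c - a" "c - x"]
    by (simp add: ultrametric_ball_def natural_ultrametric_def less_eq_arch_class_iff)
qed

text \<open>The ball is the coset at \<open>c\<close> of the subgroup of all elements dominated by
  \<open>c - d\<close>, and a coset is stable under reflection in any of its points.\<close>

lemma ultrametric_ball_reflect:
  assumes "B \<in> ultrametric_balls" "a \<in> B" "b \<in> B"
  shows "a + a - b \<in> B"
proof -
  obtain c d where B: "B = ultrametric_ball c d"
    using assms(1) by (auto simp: ultrametric_balls_def)
  have "c - (a + a - b) = (c - a) - ((c - b) - (c - a))"
    by (simp add: algebra_simps)
  moreover have "arch_dominates (c - d) (c - a)" "arch_dominates (c - d) (c - b)"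
    using B assms(2-)
    by (simp_all add: ultrametric_ball_def natural_ultrametric_def less_eq_arch_class_iff)
  ultimately have "arch_dominates (c - d) (c - (a + a - b))"
    using arch_dominates_diff by metis
  then show ?thesis
    by (simp add: B ultrametric_ball_def natural_ultrametric_def less_eq_arch_class_iff)
qed

text \<open>A common edge on one side determines the ball: reflections carry the comparison at that
  edge over to the opposite side, where convexity finishes the argument.\<close>

lemma ultrametric_ball_subset_of_coinitial:
  fixes B B' :: "'a::linordered_ab_group_add set"
  assumes B: "B \<in> ultrametric_balls" "B' \<in> ultrametric_balls"
    and le: "le = (\<le>) \<or> le = (\<ge>)"
    and coinitial: "\<And>b. b \<in> B \<Longrightarrow> \<exists>b'\<in>B'. le b' b" "\<And>b'. b' \<in> B' \<Longrightarrow> \<exists>b\<in>B. le b b'"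
  shows "B \<subseteq> B'"
proof
  fix x assume x: "x \<in> B"
  then obtain d where d: "d \<in> B'" "le d x"
    using coinitial(1) by blast
  \<comment> \<open>For \<open>\<le>\<close>: reflect \<open>x\<close> in \<open>c\<close>, go down
    to \<open>e\<close> in \<open>B'\<close>, and reflect \<open>e\<close> in \<open>d\<close>. As
    \<open>c \<le> d\<close>, the result \<open>d + d - e\<close> is at least \<open>x\<close>, so
    \<open>x\<close> is enclosed between two points of \<open>B'\<close>.\<close>
  obtain c where c: "c \<in> B" "le c d"
    using coinitial(2) d(1) by blast
  obtain e where e: "e \<in> B'" "le e (c + c - x)"
    using coinitial(1) ultrametric_ball_reflect[OF B(1) c(1) x] by blast
  have r: "d + d - e \<in> B'"
    by (rule ultrametric_ball_reflect[OF B(2) d(1) e(1)])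
  from le show "x \<in> B'"
  proof
    assume [simp]: "le = (\<le>)"
    have "c + c \<le> d + d" using c(2) by (auto intro: add_mono)
    moreover have "e + x \<le> c + c" using e(2) by (simp add: algebra_simps)
    ultimately have "e + x \<le> d + d" by (rule order_trans[rotated])
    then have "x \<le> d + d - e" by (simp add: le_diff_eq add.commute)
    then show ?thesis using ultrametric_ball_convex[OF B(2) d(1) r] d(2) by simp
  next
    assume [simp]: "le = (\<ge>)"
    have "d + d \<le> c + c" using c(2) by (auto intro: add_mono)
    moreover have "c + c \<le> e + x" using e(2) by (simp add: algebra_simps)
    ultimately have "d + d \<le> e + x" by (rule order_trans)
    then have "d + d - e \<le> x" by (simp add: diff_le_eq add.commute)
    then show ?thesis using ultrametric_ball_convex[OF B(2) r d(1)] d(2) by simp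
  qed
qed

section \<open>End balls of convex finite unions\<close>

text \<open>Of two sets in a total preorder, one is coinitial for the other; the induction keeps
  whichever of the two end pieces reaches further.\<close>

lemma finite_union_coinitial_piece:
  assumes "finite \<F>" "\<F> \<noteq> {}"
    and total: "\<And>x y. le x y \<or> le y x"
    and trans: "\<And>x y z. le x y \<Longrightarrow> le y z \<Longrightarrow> le x z"
    and pieces: "\<And>F. F \<in> \<F> \<Longrightarrow> \<exists>B\<in>\<B>. B \<subseteq> F \<and> (\<forall>s\<in>F. \<exists>b\<in>B. le b s)"
  shows "\<exists>B\<in>\<B>. B \<subseteq> \<Union>\<F> \<and> (\<forall>s\<in>\<Union>\<F>. \<exists>b\<in>B. le b s)"
  using assms(1,2) pieces
proof (induction rule: finite_ne_induct)
  case (singleton F)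
  then show ?case by simp
next
  case (insert F \<F>)
  obtain B where B: "B \<in> \<B>" "B \<subseteq> F" "\<forall>s\<in>F. \<exists>b\<in>B. le b s"
    using insert.prems[OF insertI1] by metis
  obtain C where C: "C \<in> \<B>" "C \<subseteq> \<Union>\<F>" "\<forall>s\<in>\<Union>\<F>. \<exists>b\<in>C. le b s"
    using insert.IH[OF insert.prems[OF insertI2]] by metis
  show ?case
  proof (cases "\<forall>c\<in>C. \<exists>b\<in>B. le b c")
    case True
    then have "\<exists>b\<in>B. le b s" if "s \<in> \<Union>\<F>" for s
      using that C(3) trans by meson
    then have "\<forall>s\<in>\<Union>(insert F \<F>). \<exists>b\<in>B. le b s"
      using B(3) by blast
    moreover have "B \<subseteq> \<Union>(insert F \<F>)" using B(2) by auto
    ultimately show ?thesis using B(1) by (intro bexI[of _ B] conjI)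
  next
    case False
    then obtain c where "c \<in> C" "\<forall>b\<in>B. le c b"
      using total by blast
    then have "\<exists>b\<in>C. le b s" if "s \<in> F" for s
      using that B(3) trans by meson
    then have "\<forall>s\<in>\<Union>(insert F \<F>). \<exists>b\<in>C. le b s"
      using C(3) by blast
    moreover have "C \<subseteq> \<Union>(insert F \<F>)" using C(2) by auto
    ultimately show ?thesis using C(1) by (intro bexI[of _ C] conjI)
  qed
qed

text \<open>A ball serves as its own end piece, and an interval contributes the singleton ball at
  its endpoint: the left one for \<open>\<le>\<close>, the right one for
  \<open>\<ge>\<close>.\<close>

lemma convex_finite_unions_end_ball:
  fixes S :: "'a::linordered_ab_group_add set"
  assumes "S \<in> convex_finite_unions" and le: "le = (\<le>) \<or> le = (\<ge>)"
  shows "\<exists>B\<in>ultrametric_balls. B \<subseteq> S \<and> (\<forall>s\<in>S. \<exists>b\<in>B. le b s)"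
proof -
  obtain \<F> where \<F>: "finite \<F>" "\<F> \<subseteq> closed_bounded_intervals \<union> ultrametric_balls" "S = \<Union>\<F>"
      "S \<noteq> {}"
    using assms(1) by (auto simp: convex_finite_unions_def)
  have singleton: "{a} \<in> ultrametric_balls" for a :: 'a
    using ultrametric_ball_singleton[of a] by (auto simp: ultrametric_balls_def)
  have pieces: "\<exists>B\<in>ultrametric_balls. B \<subseteq> F \<and> (\<forall>s\<in>F. \<exists>b\<in>B. le b s)" if F: "F \<in> \<F>" for F
  proof (cases "F \<in> ultrametric_balls")
    case True
    then show ?thesis using le by (intro bexI[of _ F]) auto
  next
    case False
    then obtain a b where "F = {a..b}" "a \<le> b"
      using F \<F>(2) by (auto simp: closed_bounded_intervals_def)
    then have "\<exists>c\<in>F. \<forall>s\<in>F. le c s"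
      using le by fastforce
    then obtain c where "c \<in> F" "\<forall>s\<in>F. le c s" by blast
    then show ?thesis by (intro bexI[OF _ singleton[of c]]) simp
  qed
  have "\<F> \<noteq> {}" using \<F>(3,4) by auto
  have total: "le x y \<or> le y x" for x y using le by auto
  have trans: "le x y \<Longrightarrow> le y z \<Longrightarrow> le x z" for x y z using le by auto
  show ?thesis
    unfolding \<F>(3)
    by (rule finite_union_coinitial_piece[OF \<F>(1) \<open>\<F> \<noteq> {}\<close> total trans pieces])
qed

lemma nest_not_realized:
  fixes \<N> :: "'a::linordered_ab_group_add set set"
  assumes nest: "nest_of_balls convex_finite_unions \<N>" and empty: "\<Inter>\<N> = {}"
    and le: "le = (\<le>) \<or> le = (\<ge>)" and S: "S \<in> \<N>"
  shows "\<exists>x\<in>{x. \<exists>T\<in>\<N>. \<forall>t\<in>T. \<not> le t x}. \<exists>s\<in>S. le s x"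
proof (rule ccontr)
  assume "\<not> ?thesis"
  \<comment> \<open>Taking \<open>x = s\<close> here, every member of the nest has points at or
    before each point of \<open>S\<close>, so members contained in \<open>S\<close> share its
    edge.\<close>
  then have S_meets: "\<exists>t\<in>T. le t x" if "T \<in> \<N>" "s \<in> S" "le s x" for T x s
    using that by blast
  have trans: "le x y \<Longrightarrow> le y z \<Longrightarrow> le x z" for x y z using le by auto
  have refl: "le x x" for x using le by auto
  have balls: "\<N> \<subseteq> convex_finite_unions"
    and chain: "\<And>S T. S \<in> \<N> \<Longrightarrow> T \<in> \<N> \<Longrightarrow> S \<subseteq> T \<or> T \<subseteq> S"
    using nest by (auto simp: nest_of_balls_def chains_def chain_subset_def)
  obtain B where B: "B \<in> ultrametric_balls" "B \<subseteq> S" "\<forall>s\<in>S. \<exists>b\<in>B. le b s"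
    using convex_finite_unions_end_ball[OF subsetD[OF balls S] le] by metis
  have "B \<subseteq> T" if T: "T \<in> \<N>" for T
  proof (cases "S \<subseteq> T")
    case True
    then show ?thesis using B(2) by blast
  next
    case False
    then have "T \<subseteq> S" using chain S T by blast
    obtain C where C: "C \<in> ultrametric_balls" "C \<subseteq> T" "\<forall>s\<in>T. \<exists>b\<in>C. le b s"
      using convex_finite_unions_end_ball[OF subsetD[OF balls T] le] by metis
    \<comment> \<open>The end balls of \<open>S\<close> and of the smaller member \<open>T\<close>
      have the same edge: one direction is \<open>S_meets\<close>, the other is
      \<open>C \<subseteq> T \<subseteq> S\<close>.\<close>
    have "B \<subseteq> C"
    proof (rule ultrametric_ball_subset_of_coinitial[OF B(1) C(1) le])
      show "\<exists>c\<in>C. le c b" if "b \<in> B" for b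
        using S_meets[OF T subsetD[OF B(2) that] refl] C(3) trans by meson
      show "\<exists>b\<in>B. le b c" if "c \<in> C" for c
        using that C(2) B(3) \<open>T \<subseteq> S\<close> by blast
    qed
    then show ?thesis using C(2) by blast
  qed
  then have "B \<subseteq> \<Inter>\<N>" by blast
  moreover have "S \<noteq> {}" using S balls by (auto simp: convex_finite_unions_def)
  ultimately show False using B(3) empty by blast
qed

section \<open>Spherical completeness\<close>

lemma spherically_complete_convex_finite_unions:
  assumes "symmetrically_complete TYPE('a::linordered_ab_group_add)"
  shows "spherically_complete (convex_finite_unions :: 'a set set)"
  unfolding spherically_complete_def
proof (intro allI impI notI)
  fix \<N> :: "'a set set"
  assume nest: "nest_of_balls convex_finite_unions \<N>" and empty: "\<Inter>\<N> = {}"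
  have balls: "\<N> \<subseteq> convex_finite_unions" and ne: "\<N> \<noteq> {}"
    and chain: "\<And>S T. S \<in> \<N> \<Longrightarrow> T \<in> \<N> \<Longrightarrow> S \<subseteq> T \<or> T \<subseteq> S"
    using nest by (auto simp: nest_of_balls_def chains_def chain_subset_def)
  define L where "L = {x. \<exists>S\<in>\<N>. \<forall>s\<in>S. \<not> s \<le> x}"
  define U where "U = {x. \<exists>S\<in>\<N>. \<forall>s\<in>S. \<not> x \<le> s}"
  have L: "\<exists>x\<in>L. \<exists>s\<in>S. s \<le> x" if "S \<in> \<N>" for S
    using nest_not_realized[OF nest empty _ that, of "(\<le>)"] by (simp add: L_def)
  have U: "\<exists>x\<in>U. \<exists>s\<in>S. x \<le> s" if "S \<in> \<N>" for S
    using nest_not_realized[OF nest empty _ that, of "(\<ge>)"] by (simp add: U_def)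
  have "dedekind_cut L U"
    unfolding dedekind_cut_def
  proof (intro conjI ballI)
    show "L \<noteq> {}" "U \<noteq> {}" using L U ne by blast+
    show "L \<union> U = UNIV"
    proof (rule ccontr)
      assume "L \<union> U \<noteq> UNIV"
      then obtain x where x: "x \<notin> L" "x \<notin> U" by blast
      have "x \<in> S" if S: "S \<in> \<N>" for S
      proof -
        have "order_convex S" using S balls by (auto simp: convex_finite_unions_def)
        moreover obtain s t where "s \<in> S" "s \<le> x" "t \<in> S" "x \<le> t"
          using x S unfolding L_def U_def by blast
        ultimately show ?thesis unfolding order_convex_def by meson
      qed
      then show False using empty by blast
    qed
    fix c d assume "c \<in> L" "d \<in> U"
    then obtain S T where ST: "S \<in> \<N>" "\<forall>s\<in>S. c < s" "T \<in> \<N>" "\<forall>t\<in>T. t < d"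
      by (auto simp: L_def U_def not_le)
    moreover have "S \<noteq> {}" "T \<noteq> {}"
      using ST(1,3) balls by (auto simp: convex_finite_unions_def)
    \<comment> \<open>Any point of the smaller of \<open>S\<close> and \<open>T\<close> lies in both
      and separates \<open>c\<close> from \<open>d\<close>.\<close>
    ultimately have "\<exists>z. c < z \<and> z < d" using chain[OF ST(1,3)] by blast
    then show "c < d" by auto
  qed
  moreover have "coinitiality U \<le>o cofinality (\<le>) L"
    unfolding coinitiality_def L_def U_def
    by (rule cofinality_le_of_chain[OF linear order_trans chain L[unfolded L_def] U[unfolded U_def]])
  moreover have "cofinality (\<le>) L \<le>o coinitiality U"
    unfolding coinitiality_def L_def U_def
    \<comment> \<open>Reversing the order exchanges the roles of \<open>L\<close> and
      \<open>U\<close>.\<close>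
    by (rule cofinality_le_of_chain[of "(\<ge>)",
      OF linear order_trans[rotated] chain U[unfolded U_def] L[unfolded L_def]])
  ultimately show False
    using assms unfolding symmetrically_complete_def ordIso_iff_ordLeq by metis
qed

lemma ball_space_convex_finite_unions:
  "ball_space (UNIV :: 'a::linordered_ab_group_add set) convex_finite_unions"
proof -
  have "{0..0} \<in> (closed_bounded_intervals :: 'a set set)"
    unfolding closed_bounded_intervals_def by blast
  then have "{0} \<in> (convex_finite_unions :: 'a set set)"
    by (auto simp: convex_finite_unions_def order_convex_def intro!: exI[of _ "{{0}}"])
  then show ?thesis
    by (auto simp: ball_space_def convex_finite_unions_def)
qed

theorem theorem1:
  "(symmetrically_complete TYPE('g::linordered_ab_group_add) \<longrightarrow>
      ball_space (UNIV :: 'g set) convex_finite_unions \<and>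
      spherically_complete (convex_finite_unions :: 'g set set)) \<and>
   (symmetrically_complete TYPE('k::linordered_field) \<longrightarrow>
      ball_space (UNIV :: 'k set) convex_finite_unions \<and>
      spherically_complete (convex_finite_unions :: 'k set set))"
  \<comment> \<open>The field case is the group case for the additive group, through the subclass
    relation.\<close>
  by (intro conjI impI ball_space_convex_finite_unions
      spherically_complete_convex_finite_unions)

end
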